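(* Let $k\ge 2$ and let $p=(p_1,\dots,p_k)$ and $q=(q_1,\dots,q_k)$ be arrays of positive integers with $p\prec q$ (so in particular $p_1+\dots+p_k=q_1+\dots+q_k$). Then $H(S(p_1,\dots,p_k))\ge H(S(q_1,\dots,q_k))$.
   Context: The Harary index of a connected graph $G$ is $H(G)=\sum_{\{x,y\}\subseteq V(G),\,x\ne y}\frac{1}{d(x,y)}$, $d$ the shortest-path distance. For positive integers $n_1\ge n_2\ge\dots\ge n_k$, $S(n_1,\dots,n_k)$ denotes the tree consisting of a vertex $v$ such that $S(n_1,\dots,n_k)-v$ is the disjoint union of paths $P_{n_1},\dots,P_{n_k}$ on $n_1,\dots,n_k$ vertices, with $v$ adjacent to an endvertex of each path; it has $n_1+\dots+n_k+1$ vertices. For integer arrays $x=(x_1,\dots,x_k)$, $y=(y_1,\dots,y_k)$, $x$ majorizes $y$, written $x\succ y$ (equivalently $y\prec x$), if $x_1\ge\dots\ge x_k$, $y_1\ge\dots\ge y_k$, $x_1+\dots+x_j\ge y_1+\dots+y_j$ for every $1\le j<k$, and $x_1+\dots+x_k=y_1+\dots+y_k$. *)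

theory Defs
  imports "Graph_Theory.Graph_Theory"
begin

text \<open>
  A finite simple graph is a \<^locale>\<open>pair_graph\<close>: a finite, loop-free, symmetric digraph whose arcs
  are pairs of vertices, the edge between \<open>u\<close> and \<open>v\<close> being represented by the two arcs
  \<open>(u, v)\<close> and \<open>(v, u)\<close>.

  The distance is the library's shortest-path distance for unit arc weights. It is infinite for
  unreachable vertices, and \<^const>\<open>real_of_ereal\<close> then maps it to 0; the real-valued distance and
  the Harary index below are meant for connected graphs only.
\<close>

definition gdist :: "'a pair_pre_digraph \<Rightarrow> 'a \<Rightarrow> 'a \<Rightarrow> real" where
  "gdist G x y = real_of_ereal (wf_digraph.\<mu> (with_proj G) (\<lambda>_. 1) x y)"

text \<open>
  The distance between the two elements of an unordered pair; well defined because the distance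
  in an undirected graph is symmetric (lemma \<open>pair_dist_doubleton\<close>).
\<close>

definition pair_dist :: "'a pair_pre_digraph \<Rightarrow> 'a set \<Rightarrow> real" where
  "pair_dist G e = (THE d. \<exists>x y. e = {x, y} \<and> x \<noteq> y \<and> d = gdist G x y)"

definition harary_index :: "'a pair_pre_digraph \<Rightarrow> real" where
  "harary_index G = (\<Sum>e | e \<subseteq> pverts G \<and> card e = 2. 1 / pair_dist G e)"

text \<open>
  The tree \<open>S(n\<^sub>1, \<dots>, n\<^sub>k)\<close> for the list of the \<open>n\<^sub>i\<close>: \<^const>\<open>None\<close> is the central vertex \<open>v\<close>, and
  \<open>Some (i, 0)\<close>, \<open>Some (i, 1)\<close>, \<open>\<dots>\<close> are the consecutive vertices of the path with
  index \<open>i\<close> (counted from 0), the first of which is adjacent to \<open>v\<close>.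
\<close>

definition starlike_edges :: "nat list \<Rightarrow> (nat \<times> nat) option rel" where
  "starlike_edges ns =
     {(None, Some (i, 0)) | i. i < length ns \<and> 0 < ns ! i} \<union>
     {(Some (i, j), Some (i, Suc j)) | i j. i < length ns \<and> Suc j < ns ! i}"

definition starlike_tree :: "nat list \<Rightarrow> (nat \<times> nat) option pair_pre_digraph" where
  "starlike_tree ns =
     \<lparr> pverts = insert None {Some (i, j) | i j. i < length ns \<and> j < ns ! i},
       parcs = starlike_edges ns \<union> (starlike_edges ns)\<inverse> \<rparr>"

definition majorizes :: "'a::linordered_semidom list \<Rightarrow> 'a list \<Rightarrow> bool" (infix "\<succ>" 50) where
  "x \<succ> y \<longleftrightarrow>
     length x = length y \<and> sorted_wrt (\<ge>) x \<and> sorted_wrt (\<ge>) y \<and>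
     (\<forall>j. 1 \<le> j \<and> j < length x \<longrightarrow> sum_list (take j x) \<ge> sum_list (take j y)) \<and>
     sum_list x = sum_list y"

abbreviation majorized_by :: "'a::linordered_semidom list \<Rightarrow> 'a list \<Rightarrow> bool" (infix "\<prec>" 50) where
  "y \<prec> x \<equiv> x \<succ> y"

lemma awalk_rev:
  assumes "pair_sym_digraph G" "pre_digraph.awalk (with_proj G) u p v"
  shows "pre_digraph.awalk (with_proj G) v (rev (map prod.swap p)) u"
proof -
  interpret pair_sym_digraph G by fact
  have "awalk v (rev (map prod.swap p)) u" if "awalk u p v" for u
    using that
  proof (induction p arbitrary: u)
    case Nil
    then show ?case by (auto simp: awalk_Nil_iff)
  next
    case (Cons e p)
    from Cons.prems have e: "e \<in> parcs G" "u = fst e" and p: "awalk (snd e) p v"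
      by (auto simp: awalk_Cons_iff)
    have "prod.swap e \<in> parcs G"
      using pair_sym_arcs e(1) by (cases e) (auto simp: symmetric_def sym_def)
    then have "awalk (snd e) [prod.swap e] u"
      using e by (auto simp: awalk_def intro: arc_snd_in_verts)
    with Cons.IH[OF p] show ?case by (auto intro: awalk_appendI)
  qed
  with assms(2) show ?thesis by simp
qed

lemma gdist_commute:
  assumes "pair_sym_digraph G"
  shows "gdist G x y = gdist G y x"
proof -
  interpret pair_sym_digraph G by fact
  have le: "\<mu> (\<lambda>_. 1) x y \<le> \<mu> (\<lambda>_. 1) y x" for x y
    unfolding \<mu>_def
  proof (rule INF_mono)
    fix p assume "p \<in> {p. awalk y p x}"
    then show "\<exists>q\<in>{p. awalk x p y}. ereal (awalk_cost (\<lambda>_. 1) q) \<le> ereal (awalk_cost (\<lambda>_. 1) p)"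
      using awalk_rev[OF assms, of y p x]
      by (intro bexI[of _ "rev (map prod.swap p)"]) (auto simp: awalk_cost_def sum_list_triv)
  qed
  show ?thesis unfolding gdist_def using le[of x y] le[of y x] by simp
qed

lemma pair_dist_doubleton:
  assumes "pair_sym_digraph G" "x \<noteq> y"
  shows "pair_dist G {x, y} = gdist G x y"
  unfolding pair_dist_def
  using assms gdist_commute[OF assms(1)]
  by (intro the_equality) (auto simp: doubleton_eq_iff)

lemma finite_pverts_starlike_tree: "finite (pverts (starlike_tree ns))"
proof -
  have "{Some (i, j) | i j. i < length ns \<and> j < ns ! i} = Some ` (SIGMA i:{..<length ns}. {..<ns ! i})"
    by auto
  then show ?thesis by (simp add: starlike_tree_def)
qed

lemma pair_graph_starlike_tree: "pair_graph (starlike_tree ns)"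
proof -
  have sub: "parcs (starlike_tree ns) \<subseteq> pverts (starlike_tree ns) \<times> pverts (starlike_tree ns)"
    by (auto simp: starlike_tree_def starlike_edges_def)
  show ?thesis
  proof
    show "finite (parcs (starlike_tree ns))"
      using finite_subset[OF sub] finite_pverts_starlike_tree by blast
    show "symmetric (with_proj (starlike_tree ns))"
      by (auto simp: symmetric_def sym_def starlike_tree_def)
    show "fst e \<noteq> snd e" if "e \<in> parcs (starlike_tree ns)" for e
      using that by (auto simp: starlike_tree_def starlike_edges_def)
  qed (use sub finite_pverts_starlike_tree in auto)
qed

lemma card_pverts_starlike_tree: "card (pverts (starlike_tree ns)) = sum_list ns + 1"
proof -
  have "{Some (i, j) | i j. i < length ns \<and> j < ns ! i} = Some ` (SIGMA i:{..<length ns}. {..<ns ! i})"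
    by auto
  then have "card {Some (i, j) | i j. i < length ns \<and> j < ns ! i} = sum_list ns"
    by (simp add: card_image sum_list_sum_nth atLeast0LessThan)
  with finite_pverts_starlike_tree[of ns] show ?thesis
    by (auto simp: starlike_tree_def)
qed

lemma reachable_starlike_tree:
  assumes "x \<in> pverts (starlike_tree ns)" "y \<in> pverts (starlike_tree ns)"
  shows "x \<rightarrow>\<^sup>*\<^bsub>with_proj (starlike_tree ns)\<^esub> y"
proof -
  let ?G = "with_proj (starlike_tree ns)"
  interpret pair_graph "starlike_tree ns" by (rule pair_graph_starlike_tree)
  have leg: "None \<rightarrow>\<^sup>*\<^bsub>?G\<^esub> Some (i, j)" if "i < length ns" "j < ns ! i" for i j
    using that(2)
  proof (induction j)
    case 0
    with that(1) have "(None, Some (i, 0)) \<in> parcs (starlike_tree ns)"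
      by (auto simp: starlike_tree_def starlike_edges_def)
    then show ?case by auto
  next
    case (Suc j)
    with that(1) have "(Some (i, j), Some (i, Suc j)) \<in> parcs (starlike_tree ns)"
      by (auto simp: starlike_tree_def starlike_edges_def)
    moreover from Suc have "None \<rightarrow>\<^sup>*\<^bsub>?G\<^esub> Some (i, j)" by simp
    ultimately show ?case by (metis reachable_adj_trans with_proj_simps(3))
  qed
  have "None \<rightarrow>\<^sup>*\<^bsub>?G\<^esub> z" if "z \<in> pverts (starlike_tree ns)" for z
    using that leg by (auto simp: starlike_tree_def reachable_def)
  with assms show ?thesis
    by (meson reachable_trans symmetric_reachable pair_sym_arcs)
qed

end

theory Submission
  imports Defs
begin

text \<open>
  Moving one vertex from a leg to another leg that is shorter by at least two does not decrease
  the Harary index: the two legs and the centre still form a path of the same order, and the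
  number \<open>\<Sum>\<^sub>b 1 / (a + b)\<close> that a vertex at depth \<open>a\<close> contributes together with a third leg
  decreases in \<open>a\<close>. Majorization yields a chain of such moves from \<open>q\<close> to \<open>p\<close>: take the first
  \<open>a\<close> with \<open>p\<^sub>a < q\<^sub>a\<close> and then the first \<open>b\<close> with \<open>q\<^sub>b < p\<^sub>b\<close>. As \<open>p\<close> is decreasing,
  \<open>q\<^sub>a \<ge> q\<^sub>b + 2\<close>, and the partial sums still dominate after the move. The intermediate
  arrays need not be decreasing.
\<close>

section \<open>Distances\<close>

text \<open>Closed form for the distance in a starlike tree. Position \<open>j\<close> lies at depth
  \<open>j + 1\<close>, hence the \<open>+ 2\<close> for a route through the centre; on one leg, the
  two truncated differences add up to the absolute value of \<open>j - j'\<close>.\<close>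

fun leg_dist :: "(nat \<times> nat) option \<Rightarrow> (nat \<times> nat) option \<Rightarrow> nat" where
  "leg_dist None None = 0"
| "leg_dist None (Some (i, j)) = Suc j"
| "leg_dist (Some (i, j)) None = Suc j"
| "leg_dist (Some (i, j)) (Some (i', j')) =
     (if i = i' then (j - j') + (j' - j) else j + j' + 2)"

lemma leg_dist_commute: "leg_dist x y = leg_dist y x"
  by (induction x y rule: leg_dist.induct) auto

lemma leg_dist_self [simp]: "leg_dist x x = 0"
  by (induction x x rule: leg_dist.induct) auto

lemma leg_dist_eq_0: "leg_dist x y = 0 \<Longrightarrow> x = y"
  by (induction x y rule: leg_dist.induct) (auto split: if_splits)

text \<open>One arc changes the distance to a fixed vertex by at most one; summed along a walk this
  bounds its length from below.\<close>

lemma leg_dist_arc_le: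
  "(u, v) \<in> parcs (starlike_tree ns) \<Longrightarrow> leg_dist u x \<le> Suc (leg_dist v x)"
  by (cases x) (auto simp: starlike_tree_def starlike_edges_def)

lemma leg_dist_le_length:
  assumes "pre_digraph.awalk (with_proj (starlike_tree ns)) u p v"
  shows "leg_dist u v \<le> length p"
proof -
  interpret pair_graph "starlike_tree ns" by (rule pair_graph_starlike_tree)
  from assms show ?thesis
  proof (induction p arbitrary: u)
    case (Cons e p)
    then have "leg_dist (fst e) v \<le> Suc (leg_dist (snd e) v)"
      by (intro leg_dist_arc_le[of _ _ ns]) (auto simp: awalk_Cons_iff)
    with Cons show ?case by (fastforce simp: awalk_Cons_iff)
  qed (auto simp: awalk_Nil_iff)
qed

text \<open>The neighbour of \<open>y\<close> on the way to \<open>x\<close> is one deeper if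
  \<open>x\<close> lies further out on the same leg, is the start of the leg of \<open>x\<close> if
  \<open>y\<close> is the centre, and is one step towards the centre otherwise. Iterating this
  builds a walk of length \<open>leg_dist x y\<close>.\<close>

lemma closer_neighbour:
  assumes "x \<in> pverts (starlike_tree ns)" "y \<in> pverts (starlike_tree ns)"
    and "leg_dist x y = Suc n"
  obtains z where "(z, y) \<in> parcs (starlike_tree ns)" "leg_dist x z = n"
proof (cases y)
  case None
  with assms obtain i j where "x = Some (i, j)" "i < length ns" "j < ns ! i"
    by (cases x) (auto simp: starlike_tree_def)
  with None assms that[of "Some (i, 0)"] show thesis
    by (auto simp: starlike_tree_def starlike_edges_def)
next
  case (Some a)
  then obtain i j where y: "y = Some (i, j)" by (cases a) auto
  with assms have ij: "i < length ns" "j < ns ! i" by (auto simp: starlike_tree_def)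
  show thesis
  proof (cases "\<exists>j'>j. x = Some (i, j')")
    case True
    then obtain j' where "x = Some (i, j')" "j < j'" by auto
    with assms y that[of "Some (i, Suc j)"] show thesis
      by (auto simp: starlike_tree_def starlike_edges_def)
  next
    case False
    then have le: "j' \<le> j" if "x = Some (i, j')" for j'
      using that by (auto simp: not_less[symmetric])
    show thesis
    proof (cases j)
      case 0
      with le ij assms y that[of None] show thesis
        by (cases x) (auto simp: starlike_tree_def starlike_edges_def split: if_splits)
    next
      case (Suc l)
      with le ij assms y that[of "Some (i, l)"] show thesis
        by (cases x) (auto simp: starlike_tree_def starlike_edges_def split: if_splits)
    qed
  qed
qed

lemma awalk_of_leg_dist:
  assumes "x \<in> pverts (starlike_tree ns)" "y \<in> pverts (starlike_tree ns)"
  shows "\<exists>p. pre_digraph.awalk (with_proj (starlike_tree ns)) x p y \<and> length p = leg_dist x y"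
proof -
  interpret pair_graph "starlike_tree ns" by (rule pair_graph_starlike_tree)
  have "\<exists>p. awalk x p y \<and> length p = n" if "leg_dist x y = n" for n
    using that assms(2)
  proof (induction n arbitrary: y)
    case 0
    with assms(1) show ?case by (auto dest: leg_dist_eq_0 simp: awalk_Nil_iff)
  next
    case (Suc n)
    obtain z where z: "(z, y) \<in> parcs (starlike_tree ns)" "leg_dist x z = n"
      using closer_neighbour[OF assms(1) Suc.prems(2,1)] .
    then have "z \<in> pverts (starlike_tree ns)" using arc_fst_in_verts by fastforce
    with Suc.IH z obtain p where p: "awalk x p z" "length p = n" by auto
    have "awalk z [(z, y)] y" using z arc_fst_in_verts Suc.prems
      by (auto simp: awalk_Cons_iff awalk_Nil_iff)
    with p have "awalk x (p @ [(z, y)]) y" by (auto intro: awalk_appendI)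
    with p show ?case by (intro exI[of _ "p @ [(z, y)]"]) auto
  qed
  then show ?thesis by blast
qed

lemma gdist_starlike_tree:
  assumes "x \<in> pverts (starlike_tree ns)" "y \<in> pverts (starlike_tree ns)"
  shows "gdist (starlike_tree ns) x y = real (leg_dist x y)"
proof -
  interpret pair_graph "starlike_tree ns" by (rule pair_graph_starlike_tree)
  have cost: "awalk_cost (\<lambda>_. 1) p = real (length p)" for p :: "((nat \<times> nat) option \<times> (nat \<times> nat) option) list"
    by (simp add: awalk_cost_def sum_list_triv)
  obtain p where "awalk x p y" "length p = leg_dist x y"
    using awalk_of_leg_dist[OF assms] by auto
  then have "\<mu> (\<lambda>_. 1) x y \<le> ereal (real (leg_dist x y))"
    unfolding \<mu>_def by (intro INF_lower2[of p]) (auto simp: cost)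
  moreover have "ereal (real (leg_dist x y)) \<le> \<mu> (\<lambda>_. 1) x y"
    unfolding \<mu>_def by (intro INF_greatest) (auto simp: cost leg_dist_le_length)
  ultimately show ?thesis unfolding gdist_def by (metis antisym real_of_ereal.simps(1))
qed

section \<open>The Harary index as a function of the leg lengths\<close>

text \<open>Replaces unordered pairs by ordered ones, so that the sum can be split leg by leg; each
  pair is then counted twice.\<close>

lemma sum_two_subsets:
  fixes w :: "'a \<Rightarrow> 'a \<Rightarrow> 'b::comm_semiring_1"
  assumes "finite V" "\<And>x. x \<in> V \<Longrightarrow> w x x = 0"
    and "\<And>x y. x \<in> V \<Longrightarrow> y \<in> V \<Longrightarrow> w x y = w y x"
    and "\<And>x y. x \<in> V \<Longrightarrow> y \<in> V \<Longrightarrow> x \<noteq> y \<Longrightarrow> g {x, y} = w x y"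
  shows "2 * (\<Sum>e | e \<subseteq> V \<and> card e = 2. g e) = (\<Sum>x\<in>V. \<Sum>y\<in>V. w x y)"
  using assms
proof (induction V rule: finite_induct)
  case empty
  have no: "{e. e \<subseteq> ({}::'a set) \<and> card e = 2} = {}" by auto
  show ?case unfolding no by simp
next
  case (insert x V)
  let ?E = "\<lambda>V. {e. e \<subseteq> V \<and> card e = 2}"
  have split: "?E (insert x V) = ?E V \<union> (\<lambda>y. {x, y}) ` V"
  proof (intro equalityI subsetI)
    fix e assume e: "e \<in> ?E (insert x V)"
    then obtain a b where "e = {a, b}" "a \<noteq> b" by (auto simp: card_2_iff)
    with e show "e \<in> ?E V \<union> (\<lambda>y. {x, y}) ` V" by auto
  next
    fix e assume "e \<in> ?E V \<union> (\<lambda>y. {x, y}) ` V"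
    with insert.hyps show "e \<in> ?E (insert x V)" by (auto simp: card_2_iff)
  qed
  have inj: "inj_on (\<lambda>y. {x, y}) V"
    by (auto simp: inj_on_def doubleton_eq_iff)
  have "sum g (?E (insert x V)) = sum g (?E V) + (\<Sum>y\<in>V. g {x, y})"
    unfolding split using insert.hyps
    by (subst sum.union_disjoint) (auto simp: sum.reindex[OF inj])
  also have "(\<Sum>y\<in>V. g {x, y}) = (\<Sum>y\<in>V. w x y)"
    using insert.hyps insert.prems(3) by (intro sum.cong refl) (metis insertCI)
  finally have E: "sum g (?E (insert x V)) = sum g (?E V) + (\<Sum>y\<in>V. w x y)" .
  have "(\<Sum>y\<in>V. w x y) = (\<Sum>y\<in>V. w y x)"
    using insert.prems by (intro sum.cong) auto
  with E have "2 * sum g (?E (insert x V)) =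
      2 * sum g (?E V) + (\<Sum>y\<in>V. w x y) + (\<Sum>y\<in>V. w y x)"
    by (simp add: distrib_left mult_2 add.assoc)
  moreover have "2 * sum g (?E V) = (\<Sum>x\<in>V. \<Sum>y\<in>V. w x y)"
    using insert.prems by (intro insert.IH) auto
  ultimately show ?case
    using insert.hyps insert.prems(1)[of x] by (simp add: sum.distrib algebra_simps)
qed

text \<open>Twice the Harary index of a path on \<open>n + 1\<close> vertices; the diagonal terms are \<open>1 / 0 = 0\<close>.\<close>

definition path_sum :: "nat \<Rightarrow> real" where
  "path_sum n = 2 * (\<Sum>j<n. 1 / real (Suc j)) +
     (\<Sum>j<n. \<Sum>j'<n. 1 / real ((j - j') + (j' - j)))"

definition cross_sum :: "nat \<Rightarrow> nat \<Rightarrow> real" where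
  "cross_sum m n = (\<Sum>a<m. \<Sum>b<n. 1 / real (a + b + 2))"

text \<open>The cross terms range over ordered pairs of legs, in accordance with twice the Harary
  index. The index set is arbitrary so that two legs can be split off from the rest.\<close>

definition legs_sum :: "'i set \<Rightarrow> ('i \<Rightarrow> nat) \<Rightarrow> real" where
  "legs_sum I x = (\<Sum>i\<in>I. path_sum (x i)) + (\<Sum>i\<in>I. \<Sum>j\<in>I - {i}. cross_sum (x i) (x j))"

lemma sum_pverts_starlike_tree:
  "sum h (pverts (starlike_tree ns)) =
     h None + (\<Sum>i<length ns. \<Sum>j<ns ! i. h (Some (i, j)))"
proof -
  have eq: "{Some (i, j) | i j. i < length ns \<and> j < ns ! i} =
      Some ` (SIGMA i:{..<length ns}. {..<ns ! i})"
    by auto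
  show ?thesis
    by (simp add: starlike_tree_def eq image_iff sum.reindex sum.Sigma)
qed

lemma harary_index_starlike_tree:
  "2 * harary_index (starlike_tree ns) = legs_sum {..<length ns} (\<lambda>i. ns ! i)"
proof -
  let ?V = "pverts (starlike_tree ns)" and ?k = "length ns"
  interpret pair_graph "starlike_tree ns" by (rule pair_graph_starlike_tree)
  have "2 * harary_index (starlike_tree ns) = (\<Sum>x\<in>?V. \<Sum>y\<in>?V. 1 / real (leg_dist x y))"
    unfolding harary_index_def
  proof (rule sum_two_subsets)
    show "1 / pair_dist (starlike_tree ns) {x, y} = 1 / real (leg_dist x y)"
      if "x \<in> ?V" "y \<in> ?V" "x \<noteq> y" for x y
      using that pair_dist_doubleton[OF pair_sym_digraph_axioms]
      by (simp add: gdist_starlike_tree)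
  \<comment> \<open>The diagonal condition holds because \<open>leg_dist x x = 0\<close> and
    \<open>1 / 0 = 0\<close>.\<close>
  qed (auto simp: leg_dist_commute finite_pverts_starlike_tree)
  also have "\<dots> = 2 * (\<Sum>i<?k. \<Sum>j<ns ! i. 1 / real (Suc j)) +
     (\<Sum>i<?k. \<Sum>j<ns ! i. \<Sum>i'<?k. \<Sum>j'<ns ! i'. 1 / real (leg_dist (Some (i, j)) (Some (i', j'))))"
    unfolding sum_pverts_starlike_tree by (simp add: sum.distrib del: leg_dist.simps(4))
  also have "(\<Sum>i<?k. \<Sum>j<ns ! i. \<Sum>i'<?k. \<Sum>j'<ns ! i'.
        1 / real (leg_dist (Some (i, j)) (Some (i', j')))) =
      (\<Sum>i<?k. \<Sum>i'<?k. \<Sum>j<ns ! i. \<Sum>j'<ns ! i'.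
        1 / real (leg_dist (Some (i, j)) (Some (i', j'))))"
    by (intro sum.cong refl sum.swap)
  also have "\<dots> = (\<Sum>i<?k. (\<Sum>j<ns ! i. \<Sum>j'<ns ! i. 1 / real ((j - j') + (j' - j))) +
      (\<Sum>i'\<in>{..<?k} - {i}. cross_sum (ns ! i) (ns ! i')))"
    by (intro sum.cong refl) (simp add: sum.remove cross_sum_def)
  finally show ?thesis
    by (simp add: legs_sum_def path_sum_def sum.distrib sum_distrib_left)
qed

section \<open>Moving a vertex to a shorter leg\<close>

lemma cross_sum_commute: "cross_sum m n = cross_sum n m"
  unfolding cross_sum_def by (subst sum.swap) (simp add: add.commute)

lemma cross_sum_Suc: "cross_sum (Suc m) n = cross_sum m n + (\<Sum>b<n. 1 / real (m + b + 2))"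
  by (simp add: cross_sum_def)

text \<open>A new end vertex has distances 1, ..., \<open>n + 1\<close> to the old vertices of the
  path.\<close>

lemma path_sum_Suc: "path_sum (Suc n) = path_sum n + 2 * (\<Sum>j<Suc n. 1 / real (Suc j))"
proof -
  have "(\<Sum>j<n. 1 / real (n - j)) = (\<Sum>j<n. 1 / real (Suc j))"
    by (subst sum.nat_diff_reindex[symmetric]) (auto intro!: sum.cong simp: Suc_diff_Suc)
  then show ?thesis by (simp add: path_sum_def sum.distrib algebra_simps)
qed

text \<open>Two legs and the centre form a path on \<open>m + n + 1\<close> vertices, so the added
  end vertex has distances 1, ..., \<open>m + n + 1\<close> to them.\<close>

lemma path_join_Suc:
  "path_sum (Suc m) + 2 * cross_sum (Suc m) n =
     path_sum m + 2 * cross_sum m n + 2 * (\<Sum>j<Suc (m + n). 1 / real (Suc j))"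
proof -
  have "(\<Sum>j<Suc m. 1 / real (Suc j)) + (\<Sum>b<n. 1 / real (m + b + 2)) =
      (\<Sum>j<Suc (m + n). 1 / real (Suc j))"
    by (induction n) (auto simp: algebra_simps)
  then show ?thesis unfolding path_sum_Suc cross_sum_Suc by (simp add: algebra_simps)
qed

text \<open>Both sides extend the same path by one vertex, at opposite ends, and the increment
  depends only on \<open>m + n\<close>.\<close>

lemma path_join_transfer:
  "path_sum (Suc m) + path_sum n + 2 * cross_sum (Suc m) n =
     path_sum m + path_sum (Suc n) + 2 * cross_sum m (Suc n)"
  using path_join_Suc[of m n] path_join_Suc[of n m]
  by (simp only: cross_sum_commute[of n] cross_sum_commute[of "Suc n"] add.commute[of n m])

text \<open>The moved vertex passes from depth \<open>m + 1\<close> to depth \<open>n + 1\<close>,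
  so no distance to the third leg grows.\<close>

lemma cross_sum_transfer:
  assumes "n \<le> m"
  shows "cross_sum (Suc m) r + cross_sum n r \<le> cross_sum m r + cross_sum (Suc n) r"
proof -
  have "(\<Sum>b<r. 1 / real (m + b + 2)) \<le> (\<Sum>b<r. 1 / real (n + b + 2))"
    using assms by (intro sum_mono divide_left_mono) auto
  then show ?thesis by (simp add: cross_sum_Suc)
qed

lemma legs_sum_cong: "(\<And>i. i \<in> I \<Longrightarrow> x i = y i) \<Longrightarrow> legs_sum I x = legs_sum I y"
  by (simp add: legs_sum_def)

lemma legs_sum_insert:
  assumes "finite I" "a \<notin> I"
  shows "legs_sum (insert a I) x =
    legs_sum I x + path_sum (x a) + 2 * (\<Sum>j\<in>I. cross_sum (x a) (x j))"
proof -
  have "(\<Sum>i\<in>I. \<Sum>j\<in>insert a I - {i}. cross_sum (x i) (x j)) =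
      (\<Sum>i\<in>I. cross_sum (x a) (x i) + (\<Sum>j\<in>I - {i}. cross_sum (x i) (x j)))"
  proof (intro sum.cong refl)
    fix i assume "i \<in> I"
    with assms have "insert a I - {i} = insert a (I - {i})" by auto
    with assms show "(\<Sum>j\<in>insert a I - {i}. cross_sum (x i) (x j)) =
        cross_sum (x a) (x i) + (\<Sum>j\<in>I - {i}. cross_sum (x i) (x j))"
      by (simp add: cross_sum_commute)
  qed
  moreover have "insert a I - {a} = I" using assms by auto
  ultimately show ?thesis
    using assms by (simp add: legs_sum_def sum.distrib)
qed

lemma legs_sum_transfer:
  assumes "finite I" "a \<in> I" "b \<in> I" "a \<noteq> b" "x b < x a"
  shows "legs_sum I x \<le> legs_sum I (x(a := x a - 1, b := Suc (x b)))" (is "_ \<le> legs_sum I ?y")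
proof -
  define J where "J = I - {a, b}"
  have I: "I = insert a (insert b J)" and J: "finite J" "a \<notin> J" "b \<notin> J" "a \<notin> insert b J"
    using assms by (auto simp: J_def)
  obtain m where m: "x a = Suc m" using assms(5) by (cases "x a") auto
  \<comment> \<open>Three groups: pairs avoiding both legs are unchanged, the path through
    \<open>a\<close> and \<open>b\<close> keeps its value, and the terms against third legs do not
    decrease.\<close>
  have decomp: "legs_sum I z = legs_sum J z +
      (path_sum (z a) + path_sum (z b) + 2 * cross_sum (z a) (z b)) +
      2 * (\<Sum>j\<in>J. cross_sum (z a) (z j) + cross_sum (z b) (z j))" for z
    unfolding I using J by (simp add: legs_sum_insert sum.distrib algebra_simps)
  have "legs_sum J ?y = legs_sum J x"
    using J by (intro legs_sum_cong) auto
  moreover have "(\<Sum>j\<in>J. cross_sum (x a) (x j) + cross_sum (x b) (x j)) \<le>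
      (\<Sum>j\<in>J. cross_sum (?y a) (?y j) + cross_sum (?y b) (?y j))"
  proof (rule sum_mono)
    fix j assume "j \<in> J"
    then have "?y j = x j" using J by auto
    then show "cross_sum (x a) (x j) + cross_sum (x b) (x j) \<le>
        cross_sum (?y a) (?y j) + cross_sum (?y b) (?y j)"
      using cross_sum_transfer[of "x b" m "x j"] assms(4,5) m by simp
  qed
  moreover have "path_sum (x a) + path_sum (x b) + 2 * cross_sum (x a) (x b) =
      path_sum (?y a) + path_sum (?y b) + 2 * cross_sum (?y a) (?y b)"
    using path_join_transfer[of m "x b"] assms(4) m by simp
  ultimately show ?thesis unfolding decomp by linarith
qed

section \<open>Majorization\<close>

lemma exists_transfer:
  fixes x y :: "nat \<Rightarrow> nat"
  assumes dom: "\<And>j. j \<le> k \<Longrightarrow> sum x {..<j} \<le> sum y {..<j}"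
    and tot: "sum x {..<k} = sum y {..<k}" and ne: "\<exists>i<k. x i \<noteq> y i"
  obtains a b where "a < b" "b < k" "x a < y a" "y b < x b"
    "\<And>j. a < j \<Longrightarrow> j \<le> b \<Longrightarrow> sum x {..<j} < sum y {..<j}"
proof -
  define a where "a = (LEAST i. i < k \<and> x i \<noteq> y i)"
  have a: "a < k" "x a \<noteq> y a" using LeastI_ex[OF ne] by (auto simp: a_def)
  have eq: "x i = y i" if "i < a" for i
    using not_less_Least[of i "\<lambda>i. i < k \<and> x i \<noteq> y i"] that a(1) by (auto simp: a_def)
  have sum_a: "sum x {..<a} = sum y {..<a}" using eq by (intro sum.cong) auto
  \<comment> \<open>The sums before \<open>a\<close> agree, so domination at \<open>Suc a\<close>
    decides the sign of the first difference.\<close>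
  then have xa: "x a < y a" using dom[of "Suc a"] a by simp
  have strict: "sum x {..<j} < sum y {..<j}"
    if "a < j" "\<And>i. a < i \<Longrightarrow> i < j \<Longrightarrow> x i \<le> y i" for j
  proof (rule sum_strict_mono_ex1)
    show "\<forall>i\<in>{..<j}. x i \<le> y i"
      using that eq xa by (metis lessThan_iff linorder_neqE_nat order.refl less_imp_le)
  qed (use that xa in auto)
  \<comment> \<open>Otherwise the strict inequality at \<open>a\<close> would never be compensated,
    against the equality of the totals.\<close>
  have ex: "\<exists>i. a < i \<and> i < k \<and> y i < x i"
  proof (rule ccontr)
    assume "\<not> ?thesis"
    then have "sum x {..<k} < sum y {..<k}"
      using a(1) by (intro strict) (assumption, meson not_less)
    with tot show False by simp
  qed
  define b where "b = (LEAST i. a < i \<and> i < k \<and> y i < x i)"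
  have b: "a < b" "b < k" "y b < x b" using LeastI_ex[OF ex] by (auto simp: b_def)
  have "x i \<le> y i" if "a < i" "i < b" for i
    using not_less_Least[of i "\<lambda>i. a < i \<and> i < k \<and> y i < x i"] that b(2) by (auto simp: b_def)
  with strict have "sum x {..<j} < sum y {..<j}" if "a < j" "j \<le> b" for j
    using that by simp
  with that b xa show thesis by blast
qed

lemma legs_sum_antimono:
  fixes x y :: "nat \<Rightarrow> nat"
  assumes dec: "\<And>i j. i < j \<Longrightarrow> j < k \<Longrightarrow> x j \<le> x i"
    and "\<And>j. j \<le> k \<Longrightarrow> sum x {..<j} \<le> sum y {..<j}" and "sum x {..<k} = sum y {..<k}"
  shows "legs_sum {..<k} y \<le> legs_sum {..<k} x"
  using assms(2,3)
\<comment> \<open>Truncated subtraction makes the measure the total excess of \<open>y\<close> over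
  \<open>x\<close>. A move lowers it at \<open>a\<close> and leaves the term at \<open>b\<close>
  zero, since \<open>y b < x b\<close>.\<close>
proof (induction "\<Sum>i<k. y i - x i" arbitrary: y rule: less_induct)
  case less
  show ?case
  proof (cases "\<exists>i<k. x i \<noteq> y i")
    case False
    then have "legs_sum {..<k} y = legs_sum {..<k} x" by (intro legs_sum_cong) auto
    then show ?thesis by simp
  next
    case True
    from exists_transfer[OF less.prems True] obtain a b where
      ab: "a < b" "b < k" "x a < y a" "y b < x b"
      and strict: "\<And>j. a < j \<Longrightarrow> j \<le> b \<Longrightarrow> sum x {..<j} < sum y {..<j}"
      by blast
    have "x b \<le> x a" using dec ab by simp
    with ab have gap: "y b < y a" by simp
    define z where "z = y(a := y a - 1, b := Suc (y b))"
    \<comment> \<open>Only the prefixes containing \<open>a\<close> but not \<open>b\<close> lose a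
      unit; these are the ones for which \<open>strict\<close> provides slack.\<close>
    have prefix: "sum z {..<j} + (if a < j \<and> j \<le> b then 1 else 0) = sum y {..<j}" for j
    proof (induction j)
      case (Suc j)
      then show ?case using ab by (auto simp: z_def split: if_splits)
    qed simp
    have "(\<Sum>i<k. z i - x i) < (\<Sum>i<k. y i - x i)"
    proof (rule sum_strict_mono_ex1)
      show "\<forall>i\<in>{..<k}. z i - x i \<le> y i - x i" using ab by (auto simp: z_def)
      have "z a - x a < y a - x a" using ab by (simp add: z_def)
      then show "\<exists>i\<in>{..<k}. z i - x i < y i - x i" using ab by (meson lessThan_iff less_trans)
    qed simp
    moreover have "sum x {..<j} \<le> sum z {..<j}" if "j \<le> k" for j
      using prefix[of j] strict[of j] less.prems(1)[OF that] by (auto split: if_splits)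
    moreover have "sum x {..<k} = sum z {..<k}"
      using prefix[of k] less.prems(2) ab by simp
    ultimately have "legs_sum {..<k} z \<le> legs_sum {..<k} x" by (rule less.hyps)
    moreover have "legs_sum {..<k} y \<le> legs_sum {..<k} z"
      unfolding z_def using ab gap by (intro legs_sum_transfer) auto
    ultimately show ?thesis by simp
  qed
qed

theorem theorem2p5:
  fixes k :: nat and p q :: "nat list"
  assumes "k \<ge> 2"
    and "length p = k" and "length q = k"
    and "\<forall>n\<in>set p. n > 0" and "\<forall>n\<in>set q. n > 0"
    and "p \<prec> q"
  shows "harary_index (starlike_tree p) \<ge> harary_index (starlike_tree q)"
proof -
  have prefix: "sum_list (take j l) = sum ((!) l) {..<j}" if "j \<le> length l" for j and l :: "nat list"
    using that by (simp add: sum_list_sum_nth atLeast0LessThan)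
  from \<open>p \<prec> q\<close> have sorted: "sorted_wrt (\<ge>) p" and tot: "sum_list q = sum_list p"
    and dom: "\<And>j. 1 \<le> j \<Longrightarrow> j < k \<Longrightarrow> sum_list (take j p) \<le> sum_list (take j q)"
    using assms(2,3) by (auto simp: majorizes_def)
  have tot': "sum ((!) p) {..<k} = sum ((!) q) {..<k}"
    using tot prefix[of k p] prefix[of k q] assms(2,3) by simp
  have "legs_sum {..<k} ((!) q) \<le> legs_sum {..<k} ((!) p)"
  proof (rule legs_sum_antimono)
    show "p ! j \<le> p ! i" if "i < j" "j < k" for i j
      using sorted_wrt_nth_less[OF sorted \<open>i < j\<close>] that assms(2) by simp
    show "sum ((!) p) {..<j} \<le> sum ((!) q) {..<j}" if "j \<le> k" for j
    proof -
      \<comment> \<open>Majorization speaks of proper nonempty prefixes only; the empty one is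
        trivial and the full one is the equality of totals.\<close>
      consider "j = 0" | "1 \<le> j" "j < k" | "j = k" using \<open>j \<le> k\<close> by linarith
      then show ?thesis
        by cases (use dom[of j] tot' assms(2,3) in \<open>auto simp: prefix\<close>)
    qed
  qed (rule tot')
  with harary_index_starlike_tree[of p] harary_index_starlike_tree[of q] assms(2,3)
  show ?thesis by simp
qed

end
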